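(* Let $\mathbf{i}=(i_1,\ldots,i_n)$ be a reduced word and $\mathbf{m}=(m_1,\ldots,m_n)\in\mathbb{Z}^n_{\ge0}$ a multiplicity list. Suppose that $(\mathbf{i},\mathbf{m})$ satisfies condition (P). Then the generalized string polytope $\Delta_{\mathbf{i},\mathbf{m}}$ is equal to the polytope $P_{\mathbf{i},\mathbf{m}}$.
   Context: **Lie-theoretic notation.** $G$ is a connected, simply connected complex semisimple algebraic group of rank $r$ with Cartan subgroup $H$ and Borel subgroup $B$, $H\subset B\subset G$; $W$ is the Weyl group, $\Lambda$ the weight lattice, $\langle\cdot,\cdot\rangle$ the Killing form on $\Lambda\otimes\mathbb{R}$, $\alpha_1,\ldots,\alpha_r$ the positive simple roots, $\alpha_i^\vee=2\alpha_i/\langle\alpha_i,\alpha_i\rangle$ the coroots, $\varpi_1,\ldots,\varpi_r$ the fundamental weights ($\langle\varpi_i,\alpha_j^\vee\rangle=\delta_{i,j}$). For a word $\mathbf{i}=(i_1,\ldots,i_n)\in\{1,\ldots,r\}^n$ put $\beta_j=\alpha_{i_j}$ and $\varpi_{\beta_j}=\varpi_{i_j}$. The word is reduced if $s_{\beta_1}\cdots s_{\beta_n}$ is a reduced decomposition of an element of $W$. **The functions $A_j$.** For $1\le j\le n$ let $A_j(x_{j+1},\ldots,x_n)=\langle\sum_{s=j}^n m_s\varpi_{\beta_s}-\sum_{s=j+1}^n x_s\beta_s,\ \beta_j^\vee\rangle$ (so $A_n=m_n$). **The polytope $P_{\mathbf{i},\mathbf{m}}$** is the set of $(x_1,\ldots,x_n)\in\mathbb{R}^n$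 with $0\le x_j\le A_j(x_{j+1},\ldots,x_n)$ for all $1\le j\le n$. **Condition (P).** $(\mathbf{i},\mathbf{m})$ satisfies condition (P) if $m_n\ge0$ and, for every $k$ with $1\le k\le n-1$: whenever $(x_{k+1},\ldots,x_n)$ satisfies $0\le x_j\le A_j(x_{j+1},\ldots,x_n)$ for all $k+1\le j\le n$, then $A_k(x_{k+1},\ldots,x_n)\ge0$. **The generalized string polytope $\Delta_{\mathbf{i},\mathbf{m}}$.** Given $\mathbf{x}=(x_1,\ldots,x_n)$, define $\mathbf{x}^{(n)}=\mathbf{x}$ and inductively, for $k=n,\ldots,2$, $\mathbf{x}^{(k-1)}=(x^{(k-1)}_1,\ldots,x^{(k-1)}_{k-1})$ by $x_i^{(k-1)}=\min\{x_i^{(k)},\Psi^{(k)}(i)\}$, where for $1\le i\le k-1$: $\Psi^{(k)}(i)=\max\{s(i,j,k): i<j\le k,\ \beta_j=\beta_k\}$ if $\beta_i=\beta_k$, and $\Psi^{(k)}(i)=x_i^{(k)}$ otherwise, with $s(i,j,k)=x_j^{(k)}-\sum_{i<s\le j}\langle\beta_s,\beta_k^\vee\rangle x_s^{(k)}+\sum_{i\le s<j}\delta_{i_k,i_s}m_s$. Then $\Delta_{\mathbf{i},\mathbf{m}}$ is the set of $\mathbf{x}\in\mathbb{R}^n$ with $\Psi^{(k)}(i)\ge0$ for all $2\le k\le n$, $1\le i\le k-1$, and $0\le x_j\le A_j(x_{j+1},\ldots,x_n)$ for all $1\le j\le n$. *)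

theory Defs
  imports "HOL-Analysis.Analysis"
begin

definition coroot :: "'a::euclidean_space \<Rightarrow> 'a"
  where "coroot \<gamma> = (2 / (\<gamma> \<bullet> \<gamma>)) *\<^sub>R \<gamma>"

definition reflection :: "'a::euclidean_space \<Rightarrow> 'a \<Rightarrow> 'a"
  where "reflection \<gamma> v = v - (v \<bullet> coroot \<gamma>) *\<^sub>R \<gamma>"

text \<open>
  A connected, simply connected complex semisimple group \<open>G\<close> enters through its root system
  \<open>\<Phi>\<close> in the real span of the weight lattice, which is the ambient Euclidean space \<open>'a\<close>.
  The inner product of \<open>'a\<close> is the Killing form: on the Cartan subalgebra the Killing form is
  the sum over all roots \<open>\<gamma>\<close> of \<open>\<gamma>(h) \<gamma>(h')\<close>, and transporting it to the dual
  space gives the axiom \<open>killing_form\<close>.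
\<close>

locale killing_root_system =
  fixes \<Phi> :: "'a::euclidean_space set"
  assumes finite_roots: "finite \<Phi>"
    and span_roots: "span \<Phi> = UNIV"
    and zero_not_root: "0 \<notin> \<Phi>"
    and reflection_root: "\<lbrakk>\<gamma> \<in> \<Phi>; \<delta> \<in> \<Phi>\<rbrakk> \<Longrightarrow> reflection \<gamma> \<delta> \<in> \<Phi>"
    and integrality: "\<lbrakk>\<gamma> \<in> \<Phi>; \<delta> \<in> \<Phi>\<rbrakk> \<Longrightarrow> \<delta> \<bullet> coroot \<gamma> \<in> \<int>"
    and reduced: "\<lbrakk>\<gamma> \<in> \<Phi>; c *\<^sub>R \<gamma> \<in> \<Phi>\<rbrakk> \<Longrightarrow> c = 1 \<or> c = -1"
    and killing_form: "x \<bullet> y = (\<Sum>\<gamma>\<in>\<Phi>. (\<gamma> \<bullet> x) * (\<gamma> \<bullet> y))"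

locale simple_roots = killing_root_system \<Phi>
  for \<Phi> :: "'a::euclidean_space set" +
  fixes r :: nat and \<alpha> :: "nat \<Rightarrow> 'a"
  assumes simple_root: "i \<in> {1..r} \<Longrightarrow> \<alpha> i \<in> \<Phi>"
    and inj_simple: "inj_on \<alpha> {1..r}"
    and independent_simple: "independent (\<alpha> ` {1..r})"
    and pos_or_neg: "\<gamma> \<in> \<Phi> \<Longrightarrow>
          \<exists>c :: nat \<Rightarrow> nat. \<gamma> = (\<Sum>i=1..r. real (c i) *\<^sub>R \<alpha> i)
                         \<or> \<gamma> = - (\<Sum>i=1..r. real (c i) *\<^sub>R \<alpha> i)"

definition fundamental_weight :: "nat \<Rightarrow> (nat \<Rightarrow> 'a::euclidean_space) \<Rightarrow> nat \<Rightarrow> 'a"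
  where "fundamental_weight r \<alpha> i =
    (THE w. \<forall>j\<in>{1..r}. w \<bullet> coroot (\<alpha> j) = (if i = j then 1 else 0))"

lemma (in simple_roots) fundamental_weight_inner:
  assumes "i \<in> {1..r}" "j \<in> {1..r}"
  shows "fundamental_weight r \<alpha> i \<bullet> coroot (\<alpha> j) = (if i = j then 1 else 0)"
proof -
  let ?P = "\<lambda>w. \<forall>j\<in>{1..r}. w \<bullet> coroot (\<alpha> j) = (if i = j then 1 else (0::real))"
  have nz: "\<alpha> k \<bullet> \<alpha> k \<noteq> 0" if "k \<in> {1..r}" for k
    using simple_root[OF that] zero_not_root by auto
  have "\<exists>f :: 'a \<Rightarrow> real. linear f \<and>
          (\<forall>x\<in>\<alpha> ` {1..r}. f x = (if x = \<alpha> i then (\<alpha> i \<bullet> \<alpha> i) / 2 else 0))"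
    by (rule linear_independent_extend[OF independent_simple])
  then obtain f :: "'a \<Rightarrow> real" where f: "linear f"
    "\<And>k. k \<in> {1..r} \<Longrightarrow> f (\<alpha> k) = (if \<alpha> k = \<alpha> i then (\<alpha> i \<bullet> \<alpha> i) / 2 else 0)"
    by blast
  define w where "w = (\<Sum>b\<in>Basis. f b *\<^sub>R b)"
  have w: "w \<bullet> x = f x" for x
  proof -
    have "f x = f (\<Sum>b\<in>Basis. (x \<bullet> b) *\<^sub>R b)" by (simp add: euclidean_representation)
    also have "\<dots> = (\<Sum>b\<in>Basis. (x \<bullet> b) * f b)"
      using f(1) by (simp add: linear_sum linear_scale)
    also have "\<dots> = w \<bullet> x"
      by (simp add: w_def inner_sum_left inner_sum_right inner_commute mult.commute)
    finally show ?thesis by simp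
  qed
  have Pw: "?P w"
  proof
    fix k assume k: "k \<in> {1..r}"
    have "\<alpha> k = \<alpha> i \<longleftrightarrow> i = k" using inj_simple k assms(1) by (auto dest: inj_onD)
    then show "w \<bullet> coroot (\<alpha> k) = (if i = k then 1 else 0)"
      using w[of "\<alpha> k"] f(2)[OF k] nz[OF k] nz[OF assms(1)] by (auto simp: coroot_def)
  qed
  have "span (\<alpha> ` {1..r}) = UNIV"
  proof -
    have "\<Phi> \<subseteq> span (\<alpha> ` {1..r})"
    proof
      fix g assume "g \<in> \<Phi>"
      have s: "(\<Sum>i=1..r. real (c i) *\<^sub>R \<alpha> i) \<in> span (\<alpha> ` {1..r})" for c :: "nat \<Rightarrow> nat"
        by (intro span_sum span_scale span_base) auto
      from pos_or_neg[OF \<open>g \<in> \<Phi>\<close>] show "g \<in> span (\<alpha> ` {1..r})"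
        using s by (metis span_neg)
    qed
    then show ?thesis using span_roots span_minimal subspace_span by blast
  qed
  then have uniq: "v = w" if "?P v" for v
  proof -
    have "(v - w) \<bullet> x = 0" if "x \<in> \<alpha> ` {1..r}" for x
    proof -
      from that obtain k where k: "k \<in> {1..r}" "x = \<alpha> k" by auto
      have "v \<bullet> coroot (\<alpha> k) = w \<bullet> coroot (\<alpha> k)" using \<open>?P v\<close> Pw k by simp
      then show ?thesis using nz[OF k(1)] k(2) by (simp add: coroot_def inner_diff_left)
    qed
    then have "orthogonal (v - w) x" if "x \<in> span (\<alpha> ` {1..r})" for x
      using that by (meson orthogonal_def orthogonal_to_span)
    then have "orthogonal (v - w) (v - w)"
      using \<open>span (\<alpha> ` {1..r}) = UNIV\<close> by blast
    then show ?thesis by (simp add: orthogonal_def)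
  qed
  have "?P (fundamental_weight r \<alpha> i)"
    unfolding fundamental_weight_def by (rule theI[of ?P, OF Pw uniq])
  then show ?thesis using assms(2) by blast
qed

definition word_product :: "(nat \<Rightarrow> 'a::euclidean_space) \<Rightarrow> nat list \<Rightarrow> 'a \<Rightarrow> 'a"
  where "word_product \<alpha> js = foldr (\<lambda>j w. reflection (\<alpha> j) \<circ> w) js id"

definition reduced_word :: "nat \<Rightarrow> (nat \<Rightarrow> 'a::euclidean_space) \<Rightarrow> nat list \<Rightarrow> bool"
  where "reduced_word r \<alpha> js \<longleftrightarrow> set js \<subseteq> {1..r} \<and>
    (\<forall>js'. set js' \<subseteq> {1..r} \<and> word_product \<alpha> js' = word_product \<alpha> js
      \<longrightarrow> length js \<le> length js')"

text \<open>
  Words, multiplicity lists and points of \<open>n\<close>-dimensional real space are functions on \<open>nat\<close>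
  of which only the entries \<open>1, \<dots>, n\<close> matter.  The two polytopes consist of functions that are
  extensional on \<open>{1..n}\<close>, so that their elements correspond bijectively to real \<open>n\<close>-tuples.
\<close>

context
  fixes r :: nat and \<alpha> :: "nat \<Rightarrow> 'a::euclidean_space"
    and n :: nat and \<iota> :: "nat \<Rightarrow> nat" and m :: "nat \<Rightarrow> int"
begin

definition bound_A :: "nat \<Rightarrow> (nat \<Rightarrow> real) \<Rightarrow> real"
  where "bound_A j x =
    ((\<Sum>s=j..n. of_int (m s) *\<^sub>R fundamental_weight r \<alpha> (\<iota> s))
       - (\<Sum>s=j+1..n. x s *\<^sub>R \<alpha> (\<iota> s))) \<bullet> coroot (\<alpha> (\<iota> j))"

definition polytope_P :: "(nat \<Rightarrow> real) set"
  where "polytope_P =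
    {x \<in> extensional {1..n}. \<forall>j\<in>{1..n}. 0 \<le> x j \<and> x j \<le> bound_A j x}"

definition condition_P :: bool
  where "condition_P \<longleftrightarrow> 0 \<le> m n \<and>
    (\<forall>k. 1 \<le> k \<and> k + 1 \<le> n \<longrightarrow>
      (\<forall>x. (\<forall>j\<in>{k+1..n}. 0 \<le> x j \<and> x j \<le> bound_A j x) \<longrightarrow> 0 \<le> bound_A k x))"

text \<open>In \<open>string_s\<close> and \<open>string_Psi\<close> the argument \<open>y\<close> stands for the vector \<open>x^(k)\<close>.\<close>

definition string_s :: "(nat \<Rightarrow> real) \<Rightarrow> nat \<Rightarrow> nat \<Rightarrow> nat \<Rightarrow> real"
  where "string_s y i j k =
    y j - (\<Sum>s\<in>{i<..j}. (\<alpha> (\<iota> s) \<bullet> coroot (\<alpha> (\<iota> k))) * y s)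
        + (\<Sum>s\<in>{i..<j}. if \<iota> k = \<iota> s then of_int (m s) else 0)"

definition string_Psi :: "(nat \<Rightarrow> real) \<Rightarrow> nat \<Rightarrow> nat \<Rightarrow> real"
  where "string_Psi y k i =
    (if \<alpha> (\<iota> i) = \<alpha> (\<iota> k)
     then Max {string_s y i j k | j. i < j \<and> j \<le> k \<and> \<alpha> (\<iota> j) = \<alpha> (\<iota> k)}
     else y i)"

text \<open>
  \<open>string_iter x d\<close> is \<open>x^(n - d)\<close>; only its entries \<open>1, \<dots>, n - d\<close> are meaningful.
\<close>

primrec string_iter :: "(nat \<Rightarrow> real) \<Rightarrow> nat \<Rightarrow> nat \<Rightarrow> real"
  where "string_iter x 0 = x"
  | "string_iter x (Suc d) =
      (\<lambda>i. min (string_iter x d i) (string_Psi (string_iter x d) (n - d) i))"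

definition gen_string_polytope :: "(nat \<Rightarrow> real) set"
  where "gen_string_polytope =
    {x \<in> extensional {1..n}.
       (\<forall>k\<in>{2..n}. \<forall>i\<in>{1..k-1}. 0 \<le> string_Psi (string_iter x (n - k)) k i) \<and>
       (\<forall>j\<in>{1..n}. 0 \<le> x j \<and> x j \<le> bound_A j x)}"

end

end

theory Submission
  imports Defs
begin

text \<open>
  Let \<open>p\<close> be the next occurrence of the root \<open>\<beta>\<^sub>i\<close> after position \<open>i\<close>.  Given a point \<open>x\<close> of
  \<open>P\<close>, replace \<open>x\<^sub>p\<close> by its upper bound \<open>A\<^sub>p(x)\<close> and the entries strictly between \<open>i\<close> and \<open>p\<close>
  by \<open>0\<close>.  By condition (P) this again satisfies the inequalities of \<open>P\<close> beyond \<open>i\<close>, and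
  \<open>A\<^sub>i \<ge> 0\<close> at the new point reads \<open>m\<^sub>i - A\<^sub>p(x) \<ge> 0\<close>; hence \<open>x\<^sub>p \<le> m\<^sub>i\<close>.  Since \<open>x^(k)\<close> is
  bounded above by \<open>x\<close> and distinct simple roots pair nonpositively, downward induction on \<open>k\<close>
  shows that \<open>x^(k) \<ge> 0\<close> and that the single term \<open>s(i, p, k)\<close> already makes \<open>\<Psi>^(k)(i)\<close> nonnegative.
\<close>

text \<open>Reflecting \<open>\<alpha> i\<close> in \<open>\<alpha> j\<close> gives a root with
  coefficients 1 at \<open>\<alpha> i\<close> and \<open>- a\<close> at \<open>\<alpha> j\<close>.
  All coefficients of a root have one sign, so the 1 forces \<open>- a\<close> to be
  nonnegative.\<close>

lemma (in simple_roots) simple_roots_inner_coroot_nonpos: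
  assumes i: "i \<in> {1..r}" and j: "j \<in> {1..r}" and "i \<noteq> j"
  shows "\<alpha> i \<bullet> coroot (\<alpha> j) \<le> 0"
proof -
  define a where "a = \<alpha> i \<bullet> coroot (\<alpha> j)"
  have coord: "c i = 1 \<and> c j = - a"
    if "\<alpha> i - a *\<^sub>R \<alpha> j = (\<Sum>l=1..r. c l *\<^sub>R \<alpha> l)" for c
  proof -
    \<comment> \<open>Pairing with a fundamental weight isolates one coordinate up to the nonzero
      factor \<open>(\<alpha> l \<bullet> \<alpha> l) / 2\<close>; this makes coordinates
      comparable.\<close>
    have pick: "(\<Sum>l=1..r. c l *\<^sub>R \<alpha> l) \<bullet> fundamental_weight r \<alpha> l = c l * (\<alpha> l \<bullet> \<alpha> l) / 2"
      if l: "l \<in> {1..r}" for l c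
    proof -
      have "\<alpha> q \<bullet> fundamental_weight r \<alpha> l = (if l = q then (\<alpha> l \<bullet> \<alpha> l) / 2 else 0)"
        if q: "q \<in> {1..r}" for q
        using fundamental_weight_inner[OF l q] simple_root[OF q] zero_not_root
        by (auto simp: coroot_def inner_commute field_simps split: if_splits)
      then have "(\<Sum>q=1..r. c q *\<^sub>R \<alpha> q) \<bullet> fundamental_weight r \<alpha> l
          = (\<Sum>q=1..r. if l = q then c l * (\<alpha> l \<bullet> \<alpha> l) / 2 else 0)"
        unfolding inner_sum_left by (intro sum.cong) auto
      then show ?thesis using l by simp
    qed
    let ?d = "\<lambda>l. if l = i then 1 else if l = j then - a else 0"
    have "(\<Sum>l=1..r. ?d l *\<^sub>R \<alpha> l)
        = (\<Sum>l=1..r. (if l = i then \<alpha> i else 0) + (if l = j then - a *\<^sub>R \<alpha> j else 0))"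
      using \<open>i \<noteq> j\<close> by (intro sum.cong) auto
    also have "\<dots> = \<alpha> i - a *\<^sub>R \<alpha> j"
      using i j by (simp add: sum.distrib)
    finally have "(\<Sum>l=1..r. ?d l *\<^sub>R \<alpha> l) = (\<Sum>l=1..r. c l *\<^sub>R \<alpha> l)"
      using that by simp
    then have "?d l * (\<alpha> l \<bullet> \<alpha> l) / 2 = c l * (\<alpha> l \<bullet> \<alpha> l) / 2" if "l \<in> {1..r}" for l
      using pick[OF that, of ?d] pick[OF that, of c] by simp
    moreover have "\<alpha> l \<bullet> \<alpha> l \<noteq> 0" if "l \<in> {1..r}" for l
      using simple_root[OF that] zero_not_root by auto
    ultimately have "?d l = c l" if "l \<in> {1..r}" for l
      using that by fastforce
    from this[OF i] this[OF j] show ?thesis using \<open>i \<noteq> j\<close> by simp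
  qed
  have "\<alpha> i - a *\<^sub>R \<alpha> j \<in> \<Phi>"
    using reflection_root[OF simple_root[OF j] simple_root[OF i]]
    by (simp add: reflection_def a_def)
  from pos_or_neg[OF this] obtain c :: "nat \<Rightarrow> nat" where
    "\<alpha> i - a *\<^sub>R \<alpha> j = (\<Sum>l=1..r. real (c l) *\<^sub>R \<alpha> l) \<or>
     \<alpha> i - a *\<^sub>R \<alpha> j = (\<Sum>l=1..r. (- real (c l)) *\<^sub>R \<alpha> l)"
    by (auto simp: sum_negf)
  then have "real (c i) = 1 \<and> real (c j) = - a \<or> - real (c i) = 1 \<and> - real (c j) = - a"
    using coord[of "\<lambda>l. real (c l)"] coord[of "\<lambda>l. - real (c l)"] by blast
  \<comment> \<open>The second alternative is void: minus a natural number cannot be 1.\<close>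
  then have "- a = real (c j)" by linarith
  then show ?thesis unfolding a_def[symmetric] by linarith
qed

lemma (in simple_roots) simple_root_inner_coroot_self:
  "i \<in> {1..r} \<Longrightarrow> \<alpha> i \<bullet> coroot (\<alpha> i) = 2"
  using simple_root[of i] zero_not_root by (auto simp: coroot_def)

lemma sum_atLeastAtMost_split_open:
  fixes f :: "nat \<Rightarrow> 'b::comm_monoid_add"
  assumes "i < p" "p \<le> n"
  shows "sum f {i+1..n} = sum f {i<..<p} + sum f {p..n}"
proof -
  have "{i+1..n} = {i<..<p} \<union> {p..n}" using assms by auto
  moreover have "{i<..<p} \<inter> {p..n} = {}" by auto
  ultimately show ?thesis by (metis finite_atLeastAtMost finite_greaterThanLessThan sum.union_disjoint)
qed

lemma bound_A_cong:
  "(\<And>s. j < s \<Longrightarrow> s \<le> n \<Longrightarrow> x s = y s) \<Longrightarrow> bound_A r \<alpha> n \<iota> m j x = bound_A r \<alpha> n \<iota> m j y"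
  unfolding bound_A_def by (intro arg_cong2[of _ _ _ _ inner] arg_cong2[of _ _ _ _ minus] sum.cong) auto

text \<open>Both bounds pair with the same coroot. Strictly between \<open>i\<close> and
  \<open>p\<close> the weights pair to 0 and \<open>x\<close> vanishes, so the sums differ only by
  the weight at \<open>i\<close> and the root at \<open>p\<close>, which pairs to 2.\<close>

lemma (in simple_roots) bound_A_next_occurrence:
  assumes word: "\<And>s. s \<in> {1..n} \<Longrightarrow> \<iota> s \<in> {1..r}"
    and i: "1 \<le> i" and ip: "i < p" and p: "p \<le> n" and same: "\<iota> p = \<iota> i"
    and diff: "\<And>s. i < s \<Longrightarrow> s < p \<Longrightarrow> \<iota> s \<noteq> \<iota> i"
    and zero: "\<And>s. i < s \<Longrightarrow> s < p \<Longrightarrow> x s = 0"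
  shows "bound_A r \<alpha> n \<iota> m i x = of_int (m i) + bound_A r \<alpha> n \<iota> m p x - 2 * x p"
proof -
  let ?cor = "coroot (\<alpha> (\<iota> i))"
  let ?f = "\<lambda>s. of_int (m s) *\<^sub>R (fundamental_weight r \<alpha> (\<iota> s) \<bullet> ?cor)"
  let ?g = "\<lambda>s. x s *\<^sub>R (\<alpha> (\<iota> s) \<bullet> ?cor)"
  have ii: "\<iota> i \<in> {1..r}" using word i ip p by simp
  have A: "bound_A r \<alpha> n \<iota> m q x = sum ?f {q..n} - sum ?g {q+1..n}" if "\<iota> q = \<iota> i" for q
    unfolding bound_A_def by (simp add: inner_diff_left inner_sum_left that)
  have "sum ?f {i..n} = ?f i + sum ?f {i+1..n}"
    using ip p by (simp only: sum.atLeast_Suc_atMost[of i n ?f] Suc_eq_plus1)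
  also have "sum ?f {i+1..n} = sum ?f {i<..<p} + sum ?f {p..n}"
    by (rule sum_atLeastAtMost_split_open[OF ip p])
  also have "sum ?f {i<..<p} = 0"
    using diff ip p i ii word by (intro sum.neutral) (auto simp: fundamental_weight_inner)
  also have "?f i = of_int (m i)"
    using fundamental_weight_inner[OF ii ii] by simp
  finally have f: "sum ?f {i..n} = of_int (m i) + sum ?f {p..n}" by simp
  have "sum ?g {i+1..n} = sum ?g {i<..<p} + sum ?g {p..n}"
    by (rule sum_atLeastAtMost_split_open[OF ip p])
  also have "sum ?g {i<..<p} = 0"
    using zero by (intro sum.neutral) auto
  also have "sum ?g {p..n} = ?g p + sum ?g {p+1..n}"
    using p by (simp only: sum.atLeast_Suc_atMost[of p n ?g] Suc_eq_plus1)
  also have "?g p = 2 * x p"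
    using simple_root_inner_coroot_self[OF ii] by (simp add: same)
  finally have g: "sum ?g {i+1..n} = 2 * x p + sum ?g {p+1..n}" by simp
  show ?thesis using A[of i] A[OF same] f g by simp
qed

lemma (in simple_roots) condition_P_imp_le_multiplicity:
  assumes word: "\<And>s. s \<in> {1..n} \<Longrightarrow> \<iota> s \<in> {1..r}"
    and P: "condition_P r \<alpha> n \<iota> m"
    and x: "\<And>j. j \<in> {1..n} \<Longrightarrow> 0 \<le> x j \<and> x j \<le> bound_A r \<alpha> n \<iota> m j x"
    and i: "1 \<le> i" and ip: "i < p" and p: "p \<le> n" and same: "\<iota> p = \<iota> i"
    and diff: "\<And>s. i < s \<Longrightarrow> s < p \<Longrightarrow> \<iota> s \<noteq> \<iota> i"
  shows "x p \<le> of_int (m i)"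
proof -
  let ?A = "bound_A r \<alpha> n \<iota> m"
  \<comment> \<open>The largest admissible value at \<open>p\<close> extracts the sharpest
    constraint from the bound at \<open>i\<close>. Entries up to \<open>i\<close> are 0 as well, but
    no bound used here reads them.\<close>
  define z where "z = (\<lambda>s. if s < p then 0 else if s = p then ?A p x else x s)"
  have Az: "?A j z = ?A j x" if "p \<le> j" for j
    using that by (intro bound_A_cong) (auto simp: z_def)
  \<comment> \<open>Downward from \<open>p\<close>: condition (P) at \<open>j\<close> yields
    \<open>0 \<le> ?A j z\<close>, which is exactly what makes the entry 0 admissible at
    \<open>j\<close>.\<close>
  have "\<forall>l\<in>{j..n}. 0 \<le> z l \<and> z l \<le> ?A l z" if "i < j" "j \<le> p" for j
    using \<open>j \<le> p\<close> \<open>i < j\<close>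
  proof (induction j rule: inc_induct)
    case base
    show ?case
    proof
      fix l assume l: "l \<in> {p..n}"
      then have "l \<in> {1..n}" using i ip by auto
      then have "0 \<le> z l" "z l \<le> ?A l x"
        using x[of l] l by (auto simp: z_def)
      then show "0 \<le> z l \<and> z l \<le> ?A l z"
        using Az[of l] l by simp
    qed
  next
    case (step j)
    then have IH: "\<forall>l\<in>{j+1..n}. 0 \<le> z l \<and> z l \<le> ?A l z" by simp
    then have "0 \<le> ?A j z"
      using P step.hyps step.prems p unfolding condition_P_def by auto
    moreover have "z j = 0" using step.hyps by (simp add: z_def)
    moreover have "{j..n} = insert j {j+1..n}" using step.hyps p by auto
    ultimately show ?case using IH by simp
  qed
  from this[of "i+1"] have "\<forall>l\<in>{i+1..n}. 0 \<le> z l \<and> z l \<le> ?A l z"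
    using ip by simp
  then have "0 \<le> ?A i z"
    using P i ip p unfolding condition_P_def by auto
  also have "?A i z = of_int (m i) + ?A p z - 2 * z p"
    by (rule bound_A_next_occurrence[OF word i ip p same diff]) (auto simp: z_def)
  also have "\<dots> = of_int (m i) - ?A p x"
    using Az[of p] by (simp add: z_def)
  finally show ?thesis using x[of p] i ip p by force
qed

text \<open>Stated for any nonnegative \<open>y\<close> below the multiplicities, so that it applies
  to every iterate and not only to points of the polytope.\<close>

lemma (in simple_roots) string_Psi_nonneg:
  assumes word: "\<And>s. s \<in> {1..n} \<Longrightarrow> \<iota> s \<in> {1..r}"
    and le_mult: "\<And>i p. \<lbrakk>1 \<le> i; i < p; p \<le> n; \<iota> p = \<iota> i; \<And>s. \<lbrakk>i < s; s < p\<rbrakk> \<Longrightarrow> \<iota> s \<noteq> \<iota> i\<rbrakk>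
      \<Longrightarrow> y p \<le> of_int (m i)"
    and nonneg: "\<And>s. s \<in> {1..k} \<Longrightarrow> 0 \<le> y s"
    and k: "k \<le> n" and i: "i \<in> {1..k-1}"
  shows "0 \<le> string_Psi \<alpha> \<iota> m y k i"
proof (cases "\<alpha> (\<iota> i) = \<alpha> (\<iota> k)")
  case False
  then show ?thesis using nonneg i by (auto simp: string_Psi_def)
next
  case True
  \<comment> \<open>\<open>string_Psi\<close> compares roots, whereas \<open>string_s\<close> and
    \<open>le_mult\<close> compare indices.\<close>
  have root_eq: "\<alpha> (\<iota> s) = \<alpha> (\<iota> t) \<longleftrightarrow> \<iota> s = \<iota> t" if "s \<in> {1..n}" "t \<in> {1..n}" for s t
    using inj_simple word[OF that(1)] word[OF that(2)] by (auto dest: inj_onD)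
  have ik: "\<iota> i = \<iota> k" using root_eq[of i k] True i k by auto
  define p where "p = (LEAST j. i < j \<and> \<iota> j = \<iota> i)"
  have next_k: "i < k \<and> \<iota> k = \<iota> i" using i ik by auto
  have p: "i < p" "\<iota> p = \<iota> i" "p \<le> k"
    using LeastI[of "\<lambda>j. i < j \<and> \<iota> j = \<iota> i", OF next_k]
      Least_le[of "\<lambda>j. i < j \<and> \<iota> j = \<iota> i", OF next_k]
    unfolding p_def by auto
  have diff: "\<iota> s \<noteq> \<iota> i" if "i < s" "s < p" for s
    using not_less_Least[of s "\<lambda>j. i < j \<and> \<iota> j = \<iota> i"] that unfolding p_def by auto
  have yp: "y p \<le> of_int (m i)"
    using le_mult[of i p] i p k diff by auto
  let ?c = "\<lambda>s. (\<alpha> (\<iota> s) \<bullet> coroot (\<alpha> (\<iota> k))) * y s"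
  let ?m = "\<lambda>s. if \<iota> k = \<iota> s then of_int (m s) else (0::real)"
  \<comment> \<open>The root sum contains \<open>p\<close> but not \<open>i\<close>, the
    multiplicity sum \<open>i\<close> but not \<open>p\<close>. Hence the term at \<open>p\<close>
    is \<open>y p - 2 * y p + m i\<close> minus a nonpositive sum.\<close>
  have "{i<..p} = insert p {i<..<p}" "{i..<p} = insert i {i<..<p}"
    using p by auto
  then have "sum ?c {i<..p} = ?c p + sum ?c {i<..<p}" "sum ?m {i..<p} = ?m i + sum ?m {i<..<p}"
    by (simp_all only: sum.insert[OF finite_greaterThanLessThan] greaterThanLessThan_iff less_irrefl
        simp_thms)
  moreover have "sum ?c {i<..<p} \<le> 0"
  proof (intro sum_nonpos mult_nonpos_nonneg)
    fix s assume s: "s \<in> {i<..<p}"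
    then show "0 \<le> y s" using nonneg p i by auto
    show "\<alpha> (\<iota> s) \<bullet> coroot (\<alpha> (\<iota> k)) \<le> 0"
      using s i k p diff ik by (intro simple_roots_inner_coroot_nonpos word) auto
  qed
  moreover have "?c p = 2 * y p"
    using simple_root_inner_coroot_self[of "\<iota> k"] word[of k] i k p ik by auto
  moreover have "sum ?m {i<..<p} = 0"
    using diff ik by (intro sum.neutral) force
  ultimately have "0 \<le> string_s \<alpha> \<iota> m y i p k"
    unfolding string_s_def using yp ik by simp
  moreover let ?S = "{string_s \<alpha> \<iota> m y i j k | j. i < j \<and> j \<le> k \<and> \<alpha> (\<iota> j) = \<alpha> (\<iota> k)}"
  have "string_s \<alpha> \<iota> m y i p k \<in> ?S"
    using p ik by auto
  moreover have "finite ?S"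
    by (rule finite_subset[of _ "(\<lambda>j. string_s \<alpha> \<iota> m y i j k) ` {..k}"]) auto
  ultimately have "0 \<le> Max ?S"
    using Max_ge order_trans by blast
  then show ?thesis using True by (simp add: string_Psi_def)
qed

text \<open>Each stage is a minimum with the preceding one. This carries the bound by multiplicities
  from \<open>x\<close> to all iterates.\<close>

lemma string_iter_le: "string_iter \<alpha> n \<iota> m x d i \<le> x i"
  by (induction d) (auto intro: min.coboundedI1)

theorem proposition3p14:
  fixes \<Phi> :: "'a::euclidean_space set" and r n :: nat
    and \<alpha> :: "nat \<Rightarrow> 'a" and \<iota> :: "nat \<Rightarrow> nat" and m :: "nat \<Rightarrow> int"
  assumes "simple_roots \<Phi> r \<alpha>"
    and "reduced_word r \<alpha> (map \<iota> [1..<n+1])"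
    and "\<forall>j\<in>{1..n}. 0 \<le> m j"
    and "condition_P r \<alpha> n \<iota> m"
  shows "gen_string_polytope r \<alpha> n \<iota> m = polytope_P r \<alpha> n \<iota> m"
proof -
  interpret simple_roots \<Phi> r \<alpha> by fact
  have "\<iota> ` {1..<n+1} \<subseteq> {1..r}"
    using assms(2) unfolding reduced_word_def set_map set_upt by (rule conjunct1)
  then have word: "\<iota> s \<in> {1..r}" if "s \<in> {1..n}" for s
    using that by (auto simp: image_subset_iff)
  have "0 \<le> string_Psi \<alpha> \<iota> m (string_iter \<alpha> n \<iota> m x (n - k)) k i"
    if x: "x \<in> polytope_P r \<alpha> n \<iota> m" and k: "k \<in> {2..n}" and i: "i \<in> {1..k-1}" for x k i
  proof -
    let ?y = "string_iter \<alpha> n \<iota> m x"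
    have xA: "0 \<le> x j \<and> x j \<le> bound_A r \<alpha> n \<iota> m j x" if "j \<in> {1..n}" for j
      using x that unfolding polytope_P_def by blast
    \<comment> \<open>Nonnegativity of the iterate stays a premise, so the fact serves both inside
      the induction (\<open>q = n - d\<close>) and for the final claim (\<open>d = n - k\<close>,
      \<open>q = k\<close>).\<close>
    have Psi: "0 \<le> string_Psi \<alpha> \<iota> m (?y d) q l"
      if "\<And>s. s \<in> {1..q} \<Longrightarrow> 0 \<le> ?y d s" "q \<le> n" "l \<in> {1..q-1}" for d q l
    proof (rule string_Psi_nonneg[OF word _ that])
      fix a p assume "1 \<le> a" "a < p" "p \<le> n" "\<iota> p = \<iota> a" "\<And>s. \<lbrakk>a < s; s < p\<rbrakk> \<Longrightarrow> \<iota> s \<noteq> \<iota> a"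
      then have "x p \<le> of_int (m a)"
        by (intro condition_P_imp_le_multiplicity[OF word assms(4) xA]) auto
      then show "?y d p \<le> of_int (m a)"
        using string_iter_le order_trans by blast
    qed
    \<comment> \<open>The range loses one index per stage because the minimum taken at stage
      \<open>Suc d\<close> is controlled only below \<open>n - d\<close>.\<close>
    have nonneg: "0 \<le> ?y d s" if "s \<in> {1..n - d}" for d s
      using that
    proof (induction d arbitrary: s)
      case 0
      then show ?case using xA by simp
    next
      case (Suc d)
      have "0 \<le> ?y d s" by (rule Suc.IH) (use Suc.prems in auto)
      moreover have "0 \<le> string_Psi \<alpha> \<iota> m (?y d) (n - d) s"
        by (rule Psi) (use Suc in auto)
      ultimately show ?case by simp
    qed
    show ?thesis
      by (rule Psi) (use nonneg[of _ "n - k"] k i in auto)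
  qed
  \<comment> \<open>All remaining inequalities are common to both sets.\<close>
  then show ?thesis
    unfolding gen_string_polytope_def polytope_P_def by blast
qed

end
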